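(* All quasi-crystallographs (without connected components of bipartite type $\mathcal{G}^{d_1,d_2}$) are quotient graphs: for every such quasi-crystallograph $\mathcal{Q}$ there exist an integer $N\ge1$ and nested crystallographs $\mathcal{G}'\subseteq\mathcal{G}$ on $N$ nodes, both disjoint unions of graphs of type $A$, $B$, $C$, $D$ and $BC$, such that $\mathcal{Q}$ equals the quotient graph $\mathcal{G}\setminus\mathcal{G}'$ (up to relabelling nodes).
   Context: Bichromatic graphs: nonempty finite set of nodes, unoriented straight edges $\{i,j\}$ ($i\ne j$) and loop edges $\{k\}$, each coloured red or green, such that two distinct edges with the same underlying node set have different colours. Crystallograph: a bichromatic graph such that (1) for any three distinct nodes $i,j,k$, if there are straight edges $\{i,j\}$, $\{j,k\}$ then there is a straight edge $\{i,k\}$, red if the first two have the same colour and green otherwise; (2) if a node $i$ is incident to a loop edge and to a straight edge $\{i,j\}$, then both the red and the green straight edge $\{i,j\}$ are present, as well as a loop edge at $j$ of the same colour as the one at $i$. Quasi-crystallograph: a bichromatic graph satisfying (1), satisfying (2) for red loop edges, and satisfying the following weakening of (2) for green loop edges: if a node $i$ is incident to a green loop edge and to a straight edge $\{i,j\}$, then both the red and the green straight edge $\{i,j\}$ are present (but a green loop at $j$ is not required). Bipartite type $\mathcal{G}^{d_1,d_2}$ ($d_1,d_2\ge1$): graph without loops on $I_1\sqcup I_2$, $|I_i|=d_i$, whose red edges are exactly all pairs of distinct nodes in the same part and whose green edges are exactly all pairs of nodes in different parts. Graphs on $m\ge1$ nodes: type $A$: exactly all red straight edges (an isolated node for $m=1$);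 type $D$ ($m\geq 2$): exactly all red and green straight edges; type $B$ (resp. $C$, $BC$): all red and green straight edges and a red (resp. green, resp. both a red and a green) loop at every node. A "red component" is a connected component of type $A$ (isolated nodes included); any other connected component is "bichromatic". Quotient graph $\mathcal{G}\setminus\mathcal{G}'$ (for $\mathcal{G}'\subseteq\mathcal{G}$ on the same nodes): its nodes are the red components of $\mathcal{G}'$, and its edges are exactly the following. (i) If $\mathcal{G}$ has a straight edge between nodes of two distinct red components $\mathcal{G}'(i)$, $\mathcal{G}'(j)$ of $\mathcal{G}'$, put a straight edge of the same colour between them. (ii) If $\mathcal{G}$ has a green straight edge between two nodes of a red component $\mathcal{G}'(i)$, put a green loop at $\mathcal{G}'(i)$. (iii) If $\mathcal{G}$ has a straight edge from a node of a red component $\mathcal{G}'(i)$ to a node of a bichromatic component of $\mathcal{G}'$, put a red loop at $\mathcal{G}'(i)$. (iv) If $\mathcal{G}$ has a loop edge at a node of a red component $\mathcal{G}'(i)$, put a loop of the same colour at $\mathcal{G}'(i)$. (At most one edge per colour is kept.) *)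

theory Defs
  imports Main
begin

datatype colour = Red | Green

text \<open>
  An edge is a pair of its underlying node set (two nodes for a straight edge, one node for a
  loop) and its colour. As the edges form a set of such pairs, two distinct edges with the same
  underlying node set have different colours.
\<close>

datatype 'a bigraph = Bigraph (nodes: "'a set") (edges: "('a set \<times> colour) set")

definition bichromatic_graph :: "'a bigraph \<Rightarrow> bool" where
  "bichromatic_graph G \<longleftrightarrow>
     finite (nodes G) \<and> nodes G \<noteq> {} \<and>
     (\<forall>(e, c) \<in> edges G.
        (\<exists>i\<in>nodes G. \<exists>j\<in>nodes G. i \<noteq> j \<and> e = {i, j}) \<or> (\<exists>k\<in>nodes G. e = {k}))"

definition straight :: "'a bigraph \<Rightarrow> colour \<Rightarrow> 'a \<Rightarrow> 'a \<Rightarrow> bool" where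
  "straight G c i j \<longleftrightarrow> i \<noteq> j \<and> ({i, j}, c) \<in> edges G"

definition loop :: "'a bigraph \<Rightarrow> colour \<Rightarrow> 'a \<Rightarrow> bool" where
  "loop G c k \<longleftrightarrow> ({k}, c) \<in> edges G"

definition triangle_condition :: "'a bigraph \<Rightarrow> bool" where
  "triangle_condition G \<longleftrightarrow>
     (\<forall>i\<in>nodes G. \<forall>j\<in>nodes G. \<forall>k\<in>nodes G. \<forall>c c'.
        i \<noteq> j \<and> j \<noteq> k \<and> i \<noteq> k \<and> straight G c i j \<and> straight G c' j k \<longrightarrow>
        straight G (if c = c' then Red else Green) i k)"

definition loop_condition :: "'a bigraph \<Rightarrow> colour \<Rightarrow> bool" where
  "loop_condition G c \<longleftrightarrow>
     (\<forall>i\<in>nodes G. \<forall>j\<in>nodes G. \<forall>c'.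
        loop G c i \<and> straight G c' i j \<longrightarrow>
        straight G Red i j \<and> straight G Green i j \<and> loop G c j)"

definition weak_loop_condition :: "'a bigraph \<Rightarrow> colour \<Rightarrow> bool" where
  "weak_loop_condition G c \<longleftrightarrow>
     (\<forall>i\<in>nodes G. \<forall>j\<in>nodes G. \<forall>c'.
        loop G c i \<and> straight G c' i j \<longrightarrow> straight G Red i j \<and> straight G Green i j)"

definition crystallograph :: "'a bigraph \<Rightarrow> bool" where
  "crystallograph G \<longleftrightarrow>
     bichromatic_graph G \<and> triangle_condition G \<and> (\<forall>c. loop_condition G c)"

definition quasi_crystallograph :: "'a bigraph \<Rightarrow> bool" where
  "quasi_crystallograph G \<longleftrightarrow>
     bichromatic_graph G \<and> triangle_condition G \<and>
     loop_condition G Red \<and> weak_loop_condition G Green"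

definition all_straight :: "'a set \<Rightarrow> colour \<Rightarrow> ('a set \<times> colour) set" where
  "all_straight X c = {({i, j}, c) | i j. i \<in> X \<and> j \<in> X \<and> i \<noteq> j}"

definition all_loops :: "'a set \<Rightarrow> colour \<Rightarrow> ('a set \<times> colour) set" where
  "all_loops X c = {({k}, c) | k. k \<in> X}"

text \<open>
  In the following definitions a lower bound on \<^const>\<open>card\<close> also expresses finiteness,
  since infinite sets have cardinality 0.
\<close>

definition bipartite_type :: "nat \<Rightarrow> nat \<Rightarrow> 'a bigraph \<Rightarrow> bool" where
  "bipartite_type d1 d2 G \<longleftrightarrow>
     d1 \<ge> 1 \<and> d2 \<ge> 1 \<and>
     (\<exists>I1 I2. I1 \<inter> I2 = {} \<and> nodes G = I1 \<union> I2 \<and> card I1 = d1 \<and> card I2 = d2 \<and>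
        edges G = all_straight I1 Red \<union> all_straight I2 Red \<union>
                  {({i, j}, Green) | i j. i \<in> I1 \<and> j \<in> I2})"

definition type_A :: "'a bigraph \<Rightarrow> bool" where
  "type_A G \<longleftrightarrow> card (nodes G) \<ge> 1 \<and> edges G = all_straight (nodes G) Red"

definition type_D :: "'a bigraph \<Rightarrow> bool" where
  "type_D G \<longleftrightarrow> card (nodes G) \<ge> 2 \<and>
     edges G = all_straight (nodes G) Red \<union> all_straight (nodes G) Green"

definition type_B :: "'a bigraph \<Rightarrow> bool" where
  "type_B G \<longleftrightarrow> card (nodes G) \<ge> 1 \<and>
     edges G = all_straight (nodes G) Red \<union> all_straight (nodes G) Green \<union>
               all_loops (nodes G) Red"

definition type_C :: "'a bigraph \<Rightarrow> bool" where
  "type_C G \<longleftrightarrow> card (nodes G) \<ge> 1 \<and>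
     edges G = all_straight (nodes G) Red \<union> all_straight (nodes G) Green \<union>
               all_loops (nodes G) Green"

definition type_BC :: "'a bigraph \<Rightarrow> bool" where
  "type_BC G \<longleftrightarrow> card (nodes G) \<ge> 1 \<and>
     edges G = all_straight (nodes G) Red \<union> all_straight (nodes G) Green \<union>
               all_loops (nodes G) Red \<union> all_loops (nodes G) Green"

definition classical_type :: "'a bigraph \<Rightarrow> bool" where
  "classical_type G \<longleftrightarrow> type_A G \<or> type_B G \<or> type_C G \<or> type_D G \<or> type_BC G"

definition disjoint_union :: "'a bigraph set \<Rightarrow> 'a bigraph \<Rightarrow> bool" where
  "disjoint_union F G \<longleftrightarrow>
     pairwise (\<lambda>H K. nodes H \<inter> nodes K = {}) F \<and>
     nodes G = (\<Union>H\<in>F. nodes H) \<and> edges G = (\<Union>H\<in>F. edges H)"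

definition induced :: "'a bigraph \<Rightarrow> 'a set \<Rightarrow> 'a bigraph" where
  "induced G X = Bigraph X {(e, c) \<in> edges G. e \<subseteq> X}"

definition adj :: "'a bigraph \<Rightarrow> ('a \<times> 'a) set" where
  "adj G = {(i, j). \<exists>c. straight G c i j}"

definition components :: "'a bigraph \<Rightarrow> 'a bigraph set" where
  "components G = {induced G ((adj G)\<^sup>* `` {i}) | i. i \<in> nodes G}"

definition red_components :: "'a bigraph \<Rightarrow> 'a bigraph set" where
  "red_components G = {H \<in> components G. type_A H}"

definition bichromatic_components :: "'a bigraph \<Rightarrow> 'a bigraph set" where
  "bichromatic_components G = {H \<in> components G. \<not> type_A H}"

definition subgraph :: "'a bigraph \<Rightarrow> 'a bigraph \<Rightarrow> bool" where
  "subgraph G' G \<longleftrightarrow> nodes G' = nodes G \<and> edges G' \<subseteq> edges G"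

text \<open>The nodes of the quotient graph are the red components of \<open>G'\<close>, themselves graphs.\<close>

definition quotient_graph :: "'a bigraph \<Rightarrow> 'a bigraph \<Rightarrow> 'a bigraph bigraph" where
  "quotient_graph G G' = Bigraph (red_components G')
     ({({H, K}, c) | H K c. H \<in> red_components G' \<and> K \<in> red_components G' \<and> H \<noteq> K \<and>
         (\<exists>i\<in>nodes H. \<exists>j\<in>nodes K. straight G c i j)} \<union>
      {({H}, Green) | H. H \<in> red_components G' \<and>
         (\<exists>i\<in>nodes H. \<exists>j\<in>nodes H. straight G Green i j)} \<union>
      {({H}, Red) | H. H \<in> red_components G' \<and>
         (\<exists>K\<in>bichromatic_components G'. \<exists>i\<in>nodes H. \<exists>j\<in>nodes K. \<exists>c. straight G c i j)} \<union>
      {({H}, c) | H c. H \<in> red_components G' \<and> (\<exists>i\<in>nodes H. loop G c i)})"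

definition equal_up_to_relabelling :: "'a bigraph \<Rightarrow> 'b bigraph \<Rightarrow> bool" where
  "equal_up_to_relabelling G H \<longleftrightarrow>
     (\<exists>f. bij_betw f (nodes G) (nodes H) \<and> edges H = (\<lambda>(e, c). (f ` e, c)) ` edges G)"

end

theory Submission
  imports Defs
begin

text \<open>
  Every green loop of the quasi-crystallograph \<open>Q\<close> can be produced by clause (ii) of the quotient
  construction alone. Replace each node of \<open>Q\<close> that carries a green loop by two copies, and keep
  a single copy of every other node; let \<open>p\<close> send a copy to its original. In \<open>G\<close>, distinct copies
  of one node are joined by a red and a green edge, copies of different nodes are joined as their
  originals are, red loops are inherited, and there are no green loops. In \<open>G'\<close> the only edges are
  the red ones between copies of one node. So the components of \<open>G'\<close> are the fibres of \<open>p\<close>, all of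
  type \<open>A\<close>, and the quotient has one node for each node of \<open>Q\<close>. It has the straight edges of \<open>Q\<close>
  (i), the red loops of \<open>Q\<close> (iv), no loops from clause (iii) since \<open>G'\<close> has no bichromatic
  component, and by (ii) a green loop exactly where the fibre of \<open>p\<close> has two elements, hence exactly
  where \<open>Q\<close> has one.

  The weak condition on the green loops of \<open>Q\<close> is exactly what gives \<open>G\<close> the triangle condition:
  a node that was doubled has both colours on each of its straight edges. Since \<open>G\<close> has no green
  loops, the full condition on green loops holds vacuously.

  The absence of bipartite components in \<open>Q\<close> enters in the form that nodes joined by a
  green edge are also joined by a red one (\<open>green_imp_red\<close>). This form is inherited by \<open>G\<close>, and a
  crystallograph that has it is a disjoint union of classical types (\<open>classical_decomposition\<close>).
\<close>

section \<open>Components of graphs satisfying the triangle condition\<close>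

lemma ex_colour: "(\<exists>c. P c) \<longleftrightarrow> P Red \<or> P Green"
  by (metis colour.exhaust)

lemma straight_sym: "straight G c i j \<Longrightarrow> straight G c j i"
  by (auto simp: straight_def insert_commute)

lemma straight_nodes:
  assumes "bichromatic_graph G" "straight G c i j"
  shows "i \<in> nodes G" "j \<in> nodes G" "i \<noteq> j"
proof -
  have "({i, j}, c) \<in> edges G" and ij: "i \<noteq> j"
    using assms(2) by (auto simp: straight_def)
  then have "(\<exists>a\<in>nodes G. \<exists>b\<in>nodes G. a \<noteq> b \<and> {i, j} = {a, b}) \<or> (\<exists>k\<in>nodes G. {i, j} = {k})"
    using assms(1) unfolding bichromatic_graph_def by blast
  then show "i \<in> nodes G" "j \<in> nodes G" "i \<noteq> j"
    using ij by (auto simp: doubleton_eq_iff)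
qed

lemma loop_nodes:
  assumes "bichromatic_graph G" "loop G c i"
  shows "i \<in> nodes G"
  using assms unfolding bichromatic_graph_def loop_def by fastforce

lemma edge_cases:
  assumes "bichromatic_graph G" "(e, c) \<in> edges G"
  obtains (straight) i j where "e = {i, j}" "straight G c i j"
  | (loop) k where "e = {k}" "loop G c k"
proof -
  have "(\<exists>i\<in>nodes G. \<exists>j\<in>nodes G. i \<noteq> j \<and> e = {i, j}) \<or> (\<exists>k\<in>nodes G. e = {k})"
    using assms unfolding bichromatic_graph_def by blast
  then show thesis
  proof (elim disjE bexE conjE)
    show thesis if "i \<noteq> j" "e = {i, j}" for i j
      using that assms(2) by (intro straight[of i j]) (auto simp: straight_def)
    show thesis if "e = {k}" for k
      using that assms(2) by (intro loop[of k]) (auto simp: loop_def)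
  qed
qed

lemma edges_induced:
  assumes "bichromatic_graph G"
  shows "edges (induced G X) =
    {({i, j}, c) | i j c. i \<in> X \<and> j \<in> X \<and> straight G c i j} \<union>
    {({k}, c) | k c. k \<in> X \<and> loop G c k}" (is "_ = ?R")
proof
  show "edges (induced G X) \<subseteq> ?R"
  proof
    fix x assume x: "x \<in> edges (induced G X)"
    obtain e c where ec: "x = (e, c)" by (cases x)
    have e: "(e, c) \<in> edges G" "e \<subseteq> X" using x ec by (auto simp: induced_def)
    from assms e(1) show "x \<in> ?R"
      by (cases rule: edge_cases) (use e(2) ec in auto)
  qed
  show "?R \<subseteq> edges (induced G X)"
    by (auto simp: induced_def straight_def loop_def)
qed

lemma nodes_induced [simp]: "nodes (induced G X) = X"
  by (simp add: induced_def)

lemma triangle: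
  assumes "bichromatic_graph G" "triangle_condition G"
    and "straight G c i j" "straight G c' j k" "i \<noteq> k"
  shows "straight G (if c = c' then Red else Green) i k"
  using assms straight_nodes[OF assms(1) assms(3)] straight_nodes[OF assms(1) assms(4)]
  unfolding triangle_condition_def by blast

text \<open>By the triangle condition paths can be shortened to a single edge.\<close>

lemma connected_imp_adjacent:
  assumes "bichromatic_graph G" "triangle_condition G"
    and "(i, j) \<in> (adj G)\<^sup>*" "i \<noteq> j"
  shows "\<exists>c. straight G c i j"
proof -
  from assms(3) have "i = j \<or> (\<exists>c. straight G c i j)"
  proof induction
    case base
    then show ?case by simp
  next
    case (step j k)
    then obtain c where "straight G c j k" by (auto simp: adj_def)
    with step.IH show ?case using triangle[OF assms(1,2)] by blast
  qed
  with assms(4) show ?thesis by blast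
qed

lemma connected_sym:
  assumes "(i, j) \<in> (adj G)\<^sup>*"
  shows "(j, i) \<in> (adj G)\<^sup>*"
proof -
  have "sym (adj G)"
  proof (rule symI)
    show "(j, i) \<in> adj G" if "(i, j) \<in> adj G" for i j
      using that straight_sym by (fastforce simp: adj_def)
  qed
  then show ?thesis using assms by (meson symD sym_rtrancl)
qed

text \<open>Reachability is a symmetric relation, so its classes partition the graph.\<close>

lemma disjoint_union_components:
  assumes "bichromatic_graph G"
  shows "disjoint_union (components G) G"
proof -
  let ?X = "\<lambda>i. (adj G)\<^sup>* `` {i}"
  have reach: "j \<in> nodes G" if "(i, j) \<in> (adj G)\<^sup>*" "i \<in> nodes G" for i j
    using that by induction (auto simp: adj_def dest: straight_nodes[OF assms])
  have "nodes H \<inter> nodes K = {}"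
    if HK: "H \<in> components G" "K \<in> components G" "H \<noteq> K" for H K
  proof -
    obtain i j where ij: "H = induced G (?X i)" "K = induced G (?X j)"
      using HK(1,2) by (auto simp: components_def)
    have sub: "?X i \<subseteq> ?X j" if "k \<in> ?X i" "k \<in> ?X j" for i j k
    proof
      fix l assume "l \<in> ?X i"
      have "(j, k) \<in> (adj G)\<^sup>*" "(k, i) \<in> (adj G)\<^sup>*" "(i, l) \<in> (adj G)\<^sup>*"
        using that \<open>l \<in> ?X i\<close> by (simp_all add: connected_sym)
      then show "l \<in> ?X j" by (meson Image_singleton_iff rtrancl_trans)
    qed
    have "?X i = ?X j" if "k \<in> ?X i" "k \<in> ?X j" for k
      using sub that by (intro equalityI) blast+
    then show ?thesis using HK(3) ij by auto
  qed
  moreover have "nodes G = (\<Union>H\<in>components G. nodes H)"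
  proof -
    have "(\<Union>H\<in>components G. nodes H) = (\<Union>i\<in>nodes G. ?X i)"
      by (simp add: components_def Setcompr_eq_image)
    also have "\<dots> = nodes G"
      using reach by blast
    finally show ?thesis ..
  qed
  moreover have "edges G = (\<Union>H\<in>components G. edges H)"
  proof
    show "(\<Union>H\<in>components G. edges H) \<subseteq> edges G"
      by (auto simp: components_def induced_def)
    show "edges G \<subseteq> (\<Union>H\<in>components G. edges H)"
    proof
      fix x assume x: "x \<in> edges G"
      obtain e c where ec: "x = (e, c)" by (cases x)
      have "\<exists>i\<in>nodes G. e \<subseteq> ?X i"
        using assms x[unfolded ec]
      proof (cases rule: edge_cases)
        case (straight i j)
        then have "i \<in> nodes G" "(i, j) \<in> adj G"
          using straight_nodes[OF assms] by (auto simp: adj_def)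
        then have "{i, j} \<subseteq> ?X i" by blast
        then show ?thesis using straight \<open>i \<in> nodes G\<close> by blast
      next
        case (loop k)
        then show ?thesis using loop_nodes[OF assms, of c k] by blast
      qed
      then obtain i where "i \<in> nodes G" "e \<subseteq> ?X i" by blast
      then have "x \<in> edges (induced G (?X i))" "induced G (?X i) \<in> components G"
        using x ec by (auto simp: induced_def components_def)
      then show "x \<in> (\<Union>H\<in>components G. edges H)" by blast
    qed
  qed
  ultimately show ?thesis
    by (simp add: disjoint_union_def pairwise_def)
qed

lemma finite_component:
  assumes "bichromatic_graph G" "i \<in> nodes G"
  shows "finite ((adj G)\<^sup>* `` {i})"
proof -
  have "j \<in> nodes G" if "(i, j) \<in> (adj G)\<^sup>*" for j
    using that assms(2) by induction (auto simp: adj_def dest: straight_nodes[OF assms(1)])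
  then have "(adj G)\<^sup>* `` {i} \<subseteq> nodes G" by blast
  moreover have "finite (nodes G)" using assms by (simp add: bichromatic_graph_def)
  ultimately show ?thesis by (meson finite_subset)
qed

section \<open>Graphs without bipartite components\<close>

text \<open>
  By the triangle condition, a pair of nodes joined in both colours would force both colours on
  every pair of its component; a loop would do the same, since it puts both colours on the straight
  edges at its node. So if \<open>i\<close> and \<open>j\<close> are joined in green only, their component has no loops and
  each of its pairs carries exactly one colour. It is then bipartite: one part consists of \<open>i\<close> and
  the nodes joined to it in red, the other of the nodes joined to it in green.
\<close>

lemma green_imp_red:
  assumes Q: "quasi_crystallograph Q"
    and nobip: "\<not> (\<exists>H\<in>components Q. \<exists>d1 d2. bipartite_type d1 d2 H)"
    and g: "straight Q Green i j"
  shows "straight Q Red i j"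
proof (rule ccontr)
  assume nr: "\<not> straight Q Red i j"
  have bi: "bichromatic_graph Q" and tri: "triangle_condition Q"
    and lc: "loop_condition Q Red" and wlc: "weak_loop_condition Q Green"
    using Q by (auto simp: quasi_crystallograph_def)
  note T = triangle[OF bi tri]
  have loop_both: "straight Q Red k l \<and> straight Q Green k l"
    if "loop Q c k" "straight Q c' k l" for c c' k l
    using that lc wlc straight_nodes[OF bi that(2)]
    unfolding loop_condition_def weak_loop_condition_def by (cases c) blast+
  define X where "X = (adj Q)\<^sup>* `` {i}"
  define I1 where "I1 = {k\<in>X. k = i \<or> straight Q Red i k}"
  define I2 where "I2 = {k\<in>X. straight Q Green i k}"
  have iX: "i \<in> X" and jX: "j \<in> X"
    using g by (auto simp: X_def adj_def)
  have adjacent_i: "straight Q Red i k \<or> straight Q Green i k" if "k \<in> X" "k \<noteq> i" for k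
  proof -
    have "(i, k) \<in> (adj Q)\<^sup>*" using that by (simp add: X_def)
    then obtain c where "straight Q c i k"
      using connected_imp_adjacent[OF bi tri, of i k] \<open>k \<noteq> i\<close> by metis
    then show ?thesis by (cases c) auto
  qed
  have one_i: "\<not> (straight Q Red i k \<and> straight Q Green i k)" for k
  proof
    assume k: "straight Q Red i k \<and> straight Q Green i k"
    then have "k \<noteq> j" using nr by blast
    then have "straight Q Red k j"
      using T[OF straight_sym[of Q Green i k] g] k by simp
    then have "straight Q Red i j"
      using T[of Red i k Red j] k straight_nodes(3)[OF bi g] by simp
    then show False using nr by blast
  qed
  have one: "\<not> (straight Q Red k l \<and> straight Q Green k l)" if "k \<in> X" "l \<in> X" for k l
  proof
    assume kl: "straight Q Red k l \<and> straight Q Green k l"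
    then have ni: "k \<noteq> i" "l \<noteq> i"
      using one_i straight_sym by metis+
    then obtain c where "straight Q c i k"
      using adjacent_i \<open>k \<in> X\<close> by blast
    then have "straight Q (if c = Red then Red else Green) i l"
      "straight Q (if c = Green then Red else Green) i l"
      using T[of c i k _ l] kl ni by blast+
    then show False using one_i by (cases c) auto
  qed
  have no_loop: "\<not> loop Q c k" if "k \<in> X" for c k
  proof
    assume l: "loop Q c k"
    have "\<exists>c'. \<exists>m\<in>X. straight Q c' k m"
      using adjacent_i[OF \<open>k \<in> X\<close>] iX jX g straight_sym by metis
    then show False using loop_both[OF l] one[OF \<open>k \<in> X\<close>] by blast
  qed
  have disj: "I1 \<inter> I2 = {}"
    using one_i by (auto simp: I1_def I2_def straight_def)
  have union: "X = I1 \<union> I2"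
    using adjacent_i by (auto simp: I1_def I2_def)
  have red1: "straight Q Red k l" if "k \<in> I1" "l \<in> I1" "k \<noteq> l" for k l
    using that T[of Red k i Red l] straight_sym by (fastforce simp: I1_def)
  have red2: "straight Q Red k l" if "k \<in> I2" "l \<in> I2" "k \<noteq> l" for k l
    using that T[of Green k i Green l] straight_sym by (fastforce simp: I2_def)
  have green: "straight Q Green k l" if "k \<in> I1" "l \<in> I2" for k l
    using that T[of Red k i Green l] straight_sym disj by (fastforce simp: I1_def I2_def)
  have edges: "edges (induced Q X) = all_straight I1 Red \<union> all_straight I2 Red \<union>
      {({k, l}, Green) | k l. k \<in> I1 \<and> l \<in> I2}" (is "_ = ?E")
  proof -
    have "({k, l}, c) \<in> ?E" if "k \<in> X" "l \<in> X" "straight Q c k l" for k l c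
    proof -
      have kl: "k \<noteq> l" using straight_nodes(3)[OF bi that(3)] .
      have u: "c = d" if "straight Q d k l" for d
        using one[OF \<open>k \<in> X\<close> \<open>l \<in> X\<close>] \<open>straight Q c k l\<close> that by (cases c; cases d) auto
      consider "k \<in> I1" "l \<in> I1" | "k \<in> I2" "l \<in> I2" | "k \<in> I1" "l \<in> I2" | "l \<in> I1" "k \<in> I2"
        using \<open>k \<in> X\<close> \<open>l \<in> X\<close> union by blast
      then show ?thesis
      proof cases
        case 1
        then show ?thesis using u[OF red1] kl unfolding all_straight_def by blast
      next
        case 2
        then show ?thesis using u[OF red2] kl unfolding all_straight_def by blast
      next
        case 3
        then show ?thesis using u[OF green] by blast
      next
        case 4
        then show ?thesis using u[OF straight_sym[OF green]] insert_commute by blast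
      qed
    qed
    then have "{({k, l}, c) | k l c. k \<in> X \<and> l \<in> X \<and> straight Q c k l} \<subseteq> ?E"
      by (intro subsetI, elim CollectE exE conjE) (simp only:)
    moreover have "{({k}, c) | k c. k \<in> X \<and> loop Q c k} = {}"
      using no_loop by simp
    ultimately have "edges (induced Q X) \<subseteq> ?E"
      unfolding edges_induced[OF bi] by (simp only: Un_empty_right)
    moreover have "?E \<subseteq> edges (induced Q X)"
      using red1 red2 green union unfolding edges_induced[OF bi] all_straight_def by blast
    ultimately show ?thesis by blast
  qed
  have i_node: "i \<in> nodes Q" using straight_nodes[OF bi g] by blast
  have "finite X" unfolding X_def using finite_component[OF bi i_node] .
  then have "finite I1" "finite I2" unfolding union by simp_all
  moreover have "i \<in> I1" "j \<in> I2" using iX jX g by (simp_all add: I1_def I2_def)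
  ultimately have "card I1 \<ge> 1" "card I2 \<ge> 1"
    by (auto simp: Suc_le_eq card_gt_0_iff)
  then have "bipartite_type (card I1) (card I2) (induced Q X)"
    unfolding bipartite_type_def using edges disj union by auto
  moreover have "induced Q X \<in> components Q"
    using i_node by (auto simp: components_def X_def)
  ultimately show False using nobip by blast
qed

text \<open>
  Here any two nodes of a component are joined in red. As soon as one pair is joined in green, or
  one loop is present, the triangle and loop conditions spread this through the component.
\<close>

lemma classical_decomposition:
  assumes G: "crystallograph G"
    and gr: "\<And>i j. straight G Green i j \<Longrightarrow> straight G Red i j"
  shows "\<exists>F. (\<forall>H\<in>F. classical_type H) \<and> disjoint_union F G"
proof (intro exI conjI ballI)
  have bi: "bichromatic_graph G" and tri: "triangle_condition G"
    and lc: "\<And>c. loop_condition G c"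
    using G by (auto simp: crystallograph_def)
  note T = triangle[OF bi tri]
  show "disjoint_union (components G) G"
    by (rule disjoint_union_components[OF bi])
  fix H assume "H \<in> components G"
  then obtain x where x: "x \<in> nodes G" "H = induced G ((adj G)\<^sup>* `` {x})"
    by (auto simp: components_def)
  define X where "X = (adj G)\<^sup>* `` {x}"
  have xX: "x \<in> X" and H: "H = induced G X" using x by (auto simp: X_def)
  have "finite X" unfolding X_def using finite_component[OF bi x(1)] .
  then have card1: "card X \<ge> 1" using xX by (auto simp: Suc_le_eq card_gt_0_iff)
  have red: "straight G Red k l" if "k \<in> X" "l \<in> X" "k \<noteq> l" for k l
  proof -
    have "(k, l) \<in> (adj G)\<^sup>*"
      using that connected_sym[of x k G] unfolding X_def
      by (meson Image_singleton_iff rtrancl_trans)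
    then obtain c where "straight G c k l"
      using connected_imp_adjacent[OF bi tri, of k l] \<open>k \<noteq> l\<close> by metis
    then show ?thesis using gr by (cases c) auto
  qed
  have green: "straight G Green k l"
    if ij: "i \<in> X" "j \<in> X" "straight G Green i j" and kl: "k \<in> X" "l \<in> X" "k \<noteq> l" for i j k l
  proof -
    have from_i: "straight G Green i m" if "m \<in> X" "m \<noteq> i" for m
      using T[of Green i j Red m] red[of j m] ij that by (cases "m = j") auto
    show ?thesis
    proof (cases "k = i \<or> l = i")
      case True
      then show ?thesis using from_i kl straight_sym by metis
    next
      case False
      then show ?thesis using T[of Red k i Green l] red[of k i] from_i ij kl by auto
    qed
  qed
  have loops: "loop G c l" if "k \<in> X" "loop G c k" "l \<in> X" for c k l
  proof (cases "k = l")
    case False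
    then have r: "straight G Red k l" using red that by blast
    then show ?thesis
      using lc[of c] straight_nodes[OF bi r] that unfolding loop_condition_def by blast
  qed (use that in simp)
  have loop_green: "straight G Green k l"
    if "m \<in> X" "loop G c m" "k \<in> X" "l \<in> X" "k \<noteq> l" for c k l m
  proof -
    have r: "straight G Red k l" using red that by blast
    then show ?thesis
      using lc[of c] straight_nodes[OF bi r] loops that unfolding loop_condition_def by blast
  qed
  have E: "edges H = {({k, l}, c) | k l c. k \<in> X \<and> l \<in> X \<and> straight G c k l} \<union>
      {({k}, c) | k c. k \<in> X \<and> loop G c k}"
    unfolding H edges_induced[OF bi] ..
  have X: "nodes H = X" by (simp add: H)
  show "classical_type H"
  proof (cases "\<exists>k\<in>X. \<exists>l\<in>X. k \<noteq> l \<and> \<not> straight G Green k l")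
    case True
    have no_green: "\<not> straight G Green k l" if "k \<in> X" "l \<in> X" for k l
      using True green that by blast
    have no_loop: "\<not> loop G c k" if "k \<in> X" for c k
      using True loop_green that by blast
    have "edges H = all_straight X Red"
    proof -
      have "k \<in> X \<and> l \<in> X \<and> straight G c k l \<longleftrightarrow> k \<in> X \<and> l \<in> X \<and> k \<noteq> l \<and> c = Red" for k l c
        using red no_green straight_nodes(3)[OF bi] by (cases c) blast+
      then show ?thesis using no_loop unfolding E all_straight_def by auto
    qed
    then show ?thesis
      using card1 by (simp add: classical_type_def type_A_def X)
  next
    case False
    have "k \<in> X \<and> l \<in> X \<and> straight G c k l \<longleftrightarrow> k \<in> X \<and> l \<in> X \<and> k \<noteq> l" for k l c
      using red False straight_nodes(3)[OF bi] by (cases c) blast+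
    then have "{({k, l}, c) | k l c. k \<in> X \<and> l \<in> X \<and> straight G c k l} =
        all_straight X Red \<union> all_straight X Green"
      unfolding all_straight_def by (simp add: ex_colour) blast
    moreover have "k \<in> X \<and> loop G c k \<longleftrightarrow> k \<in> X \<and> loop G c x" for c k
      using loops[of k c x] loops[of x c k] xX by blast
    then have "{({k}, c) | k c. k \<in> X \<and> loop G c k} =
        (if loop G Red x then all_loops X Red else {}) \<union>
        (if loop G Green x then all_loops X Green else {})"
      unfolding all_loops_def by (simp add: ex_colour) blast
    ultimately have E': "edges H = (all_straight X Red \<union> all_straight X Green) \<union>
        ((if loop G Red x then all_loops X Red else {}) \<union>
         (if loop G Green x then all_loops X Green else {}))"
      unfolding E by simp
    show ?thesis
    proof (cases "card X = 1")
      case True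
      then have X1: "X = {x}" using xX by (auto simp: card_1_singleton_iff)
      \<comment> \<open>A lone node without loops is of type \<open>A\<close>, as type \<open>D\<close> needs two nodes.\<close>
      have "all_straight X c = {}" for c unfolding X1 all_straight_def by auto
      then show ?thesis
        using E' card1 X
        by (auto simp: classical_type_def type_A_def type_B_def type_C_def type_BC_def)
    next
      case False
      then show ?thesis
        using E' card1 X
        by (auto simp: classical_type_def type_D_def type_B_def type_C_def type_BC_def)
    qed
  qed
qed

section \<open>Multiplying the nodes of a graph\<close>

definition graph_of ::
  "'b set \<Rightarrow> (colour \<Rightarrow> 'b \<Rightarrow> 'b \<Rightarrow> bool) \<Rightarrow> (colour \<Rightarrow> 'b \<Rightarrow> bool) \<Rightarrow> 'b bigraph" where
  "graph_of V s l = Bigraph V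
     ({({m, n}, c) | m n c. m \<in> V \<and> n \<in> V \<and> m \<noteq> n \<and> s c m n} \<union>
      {({m}, c) | m c. m \<in> V \<and> l c m})"

lemma nodes_graph_of [simp]: "nodes (graph_of V s l) = V"
  by (simp add: graph_of_def)

lemma straight_graph_of:
  assumes "\<And>c m n. s c m n \<Longrightarrow> s c n m"
  shows "straight (graph_of V s l) c m n \<longleftrightarrow> m \<in> V \<and> n \<in> V \<and> m \<noteq> n \<and> s c m n"
  using assms by (auto simp: straight_def graph_of_def doubleton_eq_iff)

lemma loop_graph_of: "loop (graph_of V s l) c m \<longleftrightarrow> m \<in> V \<and> l c m"
  by (auto simp: loop_def graph_of_def)

lemma bichromatic_graph_of:
  "finite V \<Longrightarrow> V \<noteq> {} \<Longrightarrow> bichromatic_graph (graph_of V s l)"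
  by (auto simp: bichromatic_graph_def graph_of_def)

text \<open>
  The map \<open>p\<close> sends a copy to its original. Green loops of \<open>Q\<close> are deliberately not
  copied: the quotient recovers them from the green edges inside the fibres of \<open>p\<close>.
\<close>

definition blow_up :: "'a bigraph \<Rightarrow> ('b \<Rightarrow> 'a) \<Rightarrow> 'b set \<Rightarrow> 'b bigraph" where
  "blow_up Q p V = graph_of V
     (\<lambda>c m n. p m = p n \<or> straight Q c (p m) (p n)) (\<lambda>c m. c = Red \<and> loop Q Red (p m))"

definition fibre_graph :: "('b \<Rightarrow> 'a) \<Rightarrow> 'b set \<Rightarrow> 'b bigraph" where
  "fibre_graph p V = graph_of V (\<lambda>c m n. c = Red \<and> p m = p n) (\<lambda>c m. False)"

lemma nodes_blow_up [simp]: "nodes (blow_up Q p V) = V"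
  and nodes_fibre_graph [simp]: "nodes (fibre_graph p V) = V"
  by (simp_all add: blow_up_def fibre_graph_def)

lemma straight_blow_up:
  "straight (blow_up Q p V) c m n \<longleftrightarrow>
     m \<in> V \<and> n \<in> V \<and> m \<noteq> n \<and> (p m = p n \<or> straight Q c (p m) (p n))"
  unfolding blow_up_def by (rule straight_graph_of) (auto intro: straight_sym)

lemma loop_blow_up: "loop (blow_up Q p V) c m \<longleftrightarrow> m \<in> V \<and> c = Red \<and> loop Q Red (p m)"
  by (simp add: blow_up_def loop_graph_of)

lemma straight_fibre_graph:
  "straight (fibre_graph p V) c m n \<longleftrightarrow> m \<in> V \<and> n \<in> V \<and> m \<noteq> n \<and> c = Red \<and> p m = p n"
  unfolding fibre_graph_def by (subst straight_graph_of) auto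

lemma loop_fibre_graph: "\<not> loop (fibre_graph p V) c m"
  by (simp add: fibre_graph_def loop_graph_of)

lemma subgraph_fibre_graph: "subgraph (fibre_graph p V) (blow_up Q p V)"
  by (auto simp: subgraph_def fibre_graph_def blow_up_def graph_of_def)

lemma crystallograph_fibre_graph:
  assumes "finite V" "V \<noteq> {}"
  shows "crystallograph (fibre_graph p V)"
proof -
  have "bichromatic_graph (fibre_graph p V)"
    using assms by (simp add: fibre_graph_def bichromatic_graph_of)
  then show ?thesis
    by (auto simp: crystallograph_def triangle_condition_def loop_condition_def
        straight_fibre_graph loop_fibre_graph)
qed

text \<open>
  In a triangle of the blow-up with two vertices in one fibre, the colours inside the fibre are
  arbitrary, so the remaining two edges must carry both colours; they do, because a fibre with
  two elements lies over a node with a green loop.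
\<close>

lemma crystallograph_blow_up:
  assumes Q: "quasi_crystallograph Q" and V: "finite V" "V \<noteq> {}" and p: "p ` V \<subseteq> nodes Q"
    and green: "\<And>m n. m \<in> V \<Longrightarrow> n \<in> V \<Longrightarrow> m \<noteq> n \<Longrightarrow> p m = p n \<Longrightarrow> loop Q Green (p m)"
  shows "crystallograph (blow_up Q p V)"
proof -
  have bi: "bichromatic_graph Q" and tri: "triangle_condition Q"
    and lc: "loop_condition Q Red" and wlc: "weak_loop_condition Q Green"
    using Q by (auto simp: quasi_crystallograph_def)
  have both: "straight Q d i j" if "loop Q Green i" "straight Q c i j" for c d i j
    using wlc that straight_nodes[OF bi that(2)]
    unfolding weak_loop_condition_def by (cases d) blast+
  let ?G = "blow_up Q p V"
  have "triangle_condition ?G"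
    unfolding triangle_condition_def
  proof (intro ballI allI impI, elim conjE)
    fix l m n c c'
    assume ne: "l \<noteq> m" "m \<noteq> n" "l \<noteq> n"
      and s: "straight ?G c l m" "straight ?G c' m n"
    have V': "l \<in> V" "m \<in> V" "n \<in> V" using s by (auto simp: straight_blow_up)
    let ?d = "if c = c' then Red else Green"
    have "p l = p n \<or> straight Q ?d (p l) (p n)"
    proof -
      consider "p l = p n" | "p l = p m" "straight Q c' (p m) (p n)"
        | "p m = p n" "straight Q c (p l) (p m)"
        | "p l \<noteq> p n" "straight Q c (p l) (p m)" "straight Q c' (p m) (p n)"
        using s by (auto simp: straight_blow_up)
      then show ?thesis
      proof cases
        case 2
        then show ?thesis using both green[of m l] V' ne by metis
      next
        case 3
        then have "straight Q ?d (p m) (p l)"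
          using both[OF green[of m n] straight_sym] V' ne by metis
        then show ?thesis using 3 straight_sym by metis
      next
        case 4
        then show ?thesis using triangle[OF bi tri] by blast
      qed simp
    qed
    then show "straight ?G ?d l n" using V' ne by (simp add: straight_blow_up)
  qed
  moreover have "loop_condition ?G c" for c
    unfolding loop_condition_def
  proof (intro ballI allI impI, elim conjE)
    fix m n c'
    assume l: "loop ?G c m" and s: "straight ?G c' m n"
    have mn: "m \<in> V" "n \<in> V" "m \<noteq> n" "c = Red" "loop Q Red (p m)"
      using l s by (auto simp: straight_blow_up loop_blow_up)
    have "p m = p n \<or>
        straight Q Red (p m) (p n) \<and> straight Q Green (p m) (p n) \<and> loop Q Red (p n)"
      using s mn p lc unfolding straight_blow_up loop_condition_def by blast
    then show "straight ?G Red m n \<and> straight ?G Green m n \<and> loop ?G c n"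
      using mn by (auto simp: straight_blow_up loop_blow_up)
  qed
  moreover have "bichromatic_graph ?G"
    using V by (simp add: blow_up_def bichromatic_graph_of)
  ultimately show ?thesis by (simp add: crystallograph_def)
qed

section \<open>The quotient of the blow-up by its fibres\<close>

definition fibre :: "('b \<Rightarrow> 'a) \<Rightarrow> 'b set \<Rightarrow> 'a \<Rightarrow> 'b bigraph" where
  "fibre p V i = induced (fibre_graph p V) {m \<in> V. p m = i}"

lemma nodes_fibre [simp]: "nodes (fibre p V i) = {m \<in> V. p m = i}"
  by (simp add: fibre_def)

lemma components_fibre_graph: "components (fibre_graph p V) = fibre p V ` p ` V"
proof -
  have "(adj (fibre_graph p V))\<^sup>* `` {m} = {n \<in> V. p n = p m}" if "m \<in> V" for m
  proof -
    have "n \<in> V \<and> p n = p m" if "(m, n) \<in> (adj (fibre_graph p V))\<^sup>*" for n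
      using that \<open>m \<in> V\<close> by induction (auto simp: adj_def straight_fibre_graph)
    moreover have "(m, n) \<in> (adj (fibre_graph p V))\<^sup>*" if "n \<in> V" "p n = p m" for n
      using that \<open>m \<in> V\<close>
      by (cases "m = n") (auto simp: adj_def straight_fibre_graph intro!: r_into_rtrancl)
    ultimately show ?thesis by blast
  qed
  then have "{induced (fibre_graph p V) ((adj (fibre_graph p V))\<^sup>* `` {m}) | m. m \<in> V} =
      {induced (fibre_graph p V) {n \<in> V. p n = p m} | m. m \<in> V}"
    by (metis (no_types, lifting))
  then have "components (fibre_graph p V) = (\<lambda>m. fibre p V (p m)) ` V"
    unfolding components_def fibre_def nodes_fibre_graph by blast
  then show ?thesis by (simp add: image_image)
qed

lemma type_A_fibre:
  assumes "finite V" "i \<in> p ` V"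
  shows "type_A (fibre p V i)"
proof -
  have bi: "bichromatic_graph (fibre_graph p V)"
    using crystallograph_fibre_graph[of V p] assms by (auto simp: crystallograph_def)
  have "edges (fibre p V i) = all_straight {m \<in> V. p m = i} Red"
    unfolding fibre_def edges_induced[OF bi]
    by (auto simp: all_straight_def straight_fibre_graph loop_fibre_graph)
  moreover have "card {m \<in> V. p m = i} \<ge> 1"
    using assms by (auto simp: Suc_le_eq card_gt_0_iff)
  ultimately show ?thesis by (simp add: type_A_def)
qed

lemma inj_on_fibre: "inj_on (fibre p V) (p ` V)"
proof (rule inj_onI)
  fix i j assume i: "i \<in> p ` V" and "fibre p V i = fibre p V j"
  then have "{m \<in> V. p m = i} = {m \<in> V. p m = j}" by (metis nodes_fibre)
  with i show "i = j" by blast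
qed

lemma quotient_blow_up:
  assumes bi: "bichromatic_graph Q" and V: "finite V" and p: "p ` V = nodes Q"
    and green: "\<And>i. i \<in> nodes Q \<Longrightarrow>
      loop Q Green i \<longleftrightarrow> (\<exists>m\<in>V. \<exists>n\<in>V. m \<noteq> n \<and> p m = i \<and> p n = i)"
  shows "equal_up_to_relabelling Q (quotient_graph (blow_up Q p V) (fibre_graph p V))"
proof -
  let ?C = "fibre p V" and ?G = "blow_up Q p V" and ?G' = "fibre_graph p V"
  have rc: "red_components ?G' = ?C ` nodes Q"
    using type_A_fibre[OF V, of _ p] p by (auto simp: red_components_def components_fibre_graph p)
  have bc: "bichromatic_components ?G' = {}"
    using type_A_fibre[OF V, of _ p] p by (auto simp: bichromatic_components_def components_fibre_graph p)
  have inj: "inj_on ?C (nodes Q)"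
    using inj_on_fibre[of p V] p by simp
  have str: "(\<exists>m\<in>nodes (?C i). \<exists>n\<in>nodes (?C j). straight ?G c m n) \<longleftrightarrow> straight Q c i j"
    if "i \<in> nodes Q" "j \<in> nodes Q" "i \<noteq> j" for i j c
  proof -
    obtain m n where "m \<in> V" "n \<in> V" "p m = i" "p n = j"
      using \<open>i \<in> nodes Q\<close> \<open>j \<in> nodes Q\<close> unfolding p[symmetric] by blast
    then show ?thesis using \<open>i \<noteq> j\<close> by (auto simp: straight_blow_up)
  qed
  have grn: "(\<exists>m\<in>nodes (?C i). \<exists>n\<in>nodes (?C i). straight ?G Green m n) \<longleftrightarrow> loop Q Green i"
    if "i \<in> nodes Q" for i
    using green[OF that] by (auto simp: straight_blow_up)
  have lp: "(\<exists>m\<in>nodes (?C i). loop ?G c m) \<longleftrightarrow> c = Red \<and> loop Q Red i"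
    if "i \<in> nodes Q" for i c
  proof -
    have "i \<in> p ` V" using that p by simp
    then obtain m where "m \<in> V" "p m = i" by blast
    then show ?thesis by (auto simp: loop_blow_up)
  qed
  have "edges (quotient_graph ?G ?G') =
      {({?C i, ?C j}, c) | i j c. straight Q c i j} \<union> {({?C k}, c) | k c. loop Q c k}"
    (is "?L = ?S \<union> ?K")
  proof -
    have "{({H, K}, c) | H K c. H \<in> ?C ` nodes Q \<and> K \<in> ?C ` nodes Q \<and> H \<noteq> K \<and>
         (\<exists>i\<in>nodes H. \<exists>j\<in>nodes K. straight ?G c i j)} = ?S" (is "?S' = _")
    proof
      show "?S' \<subseteq> ?S"
      proof clarify
        fix i j c m n
        assume "i \<in> nodes Q" "j \<in> nodes Q" "?C i \<noteq> ?C j" "m \<in> nodes (?C i)" "n \<in> nodes (?C j)"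
          "straight ?G c m n"
        then have "straight Q c i j" using str[of i j c] by metis
        then show "\<exists>i' j' c'. ({?C i, ?C j}, c) = ({?C i', ?C j'}, c') \<and> straight Q c' i' j'"
          by blast
      qed
      show "?S \<subseteq> ?S'"
      proof clarify
        fix i j c assume s: "straight Q c i j"
        note ij = straight_nodes[OF bi s]
        then have "?C i \<noteq> ?C j" using inj by (auto dest: inj_onD)
        then show "\<exists>H K c'. ({?C i, ?C j}, c) = ({H, K}, c') \<and> H \<in> ?C ` nodes Q \<and>
            K \<in> ?C ` nodes Q \<and> H \<noteq> K \<and> (\<exists>i\<in>nodes H. \<exists>j\<in>nodes K. straight ?G c' i j)"
          using ij str[OF ij, of c] s by blast
      qed
    qed
    moreover have "{({H}, Green) | H. H \<in> ?C ` nodes Q \<and>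
         (\<exists>i\<in>nodes H. \<exists>j\<in>nodes H. straight ?G Green i j)} =
         {({?C k}, Green) | k. loop Q Green k}"
    proof -
      have "H \<in> ?C ` nodes Q \<and> (\<exists>i\<in>nodes H. \<exists>j\<in>nodes H. straight ?G Green i j) \<longleftrightarrow>
          (\<exists>k. H = ?C k \<and> loop Q Green k)" for H
        unfolding image_iff using grn loop_nodes[OF bi, of Green] by metis
      then show ?thesis by auto
    qed
    moreover have "{({H}, c) | H c. H \<in> ?C ` nodes Q \<and> (\<exists>i\<in>nodes H. loop ?G c i)} =
         {({?C k}, Red) | k. loop Q Red k}"
    proof -
      have "H \<in> ?C ` nodes Q \<and> (\<exists>i\<in>nodes H. loop ?G c i) \<longleftrightarrow>
          c = Red \<and> (\<exists>k. H = ?C k \<and> loop Q Red k)" for H c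
        unfolding image_iff using lp loop_nodes[OF bi, of Red] by metis
      then show ?thesis by auto
    qed
    moreover have "?K = {({?C k}, Green) | k. loop Q Green k} \<union> {({?C k}, Red) | k. loop Q Red k}"
      by (simp add: ex_colour) blast
    ultimately show ?thesis
      unfolding quotient_graph_def rc bc by (simp only: bigraph.sel) blast
  qed
  also have "\<dots> = (\<lambda>(e, c). (?C ` e, c)) ` edges Q"
  proof
    show "?S \<union> ?K \<subseteq> (\<lambda>(e, c). (?C ` e, c)) ` edges Q"
      by (force simp: straight_def loop_def image_iff)
    show "(\<lambda>(e, c). (?C ` e, c)) ` edges Q \<subseteq> ?S \<union> ?K"
    proof clarify
      fix e c
      assume "(e, c) \<in> edges Q" and "\<not> (\<exists>k c'. (?C ` e, c) = ({?C k}, c') \<and> loop Q c' k)"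
      with bi show "\<exists>i j c'. (?C ` e, c) = ({?C i, ?C j}, c') \<and> straight Q c' i j"
        by (cases rule: edge_cases[where e = e and c = c and G = Q]) auto
    qed
  qed
  finally have E: "edges (quotient_graph ?G ?G') = (\<lambda>(e, c). (?C ` e, c)) ` edges Q" .
  have N: "nodes (quotient_graph ?G ?G') = ?C ` nodes Q"
    by (simp add: quotient_graph_def rc)
  show ?thesis
    unfolding equal_up_to_relabelling_def
    using inj N E by (intro exI[of _ ?C]) (simp add: bij_betw_def)
qed

lemma doubling:
  assumes "finite I" "I \<noteq> {}"
  obtains N :: nat and p where "N \<ge> 1" "p ` {1..N} = I"
    "\<forall>i\<in>I. P i \<longleftrightarrow> (\<exists>m\<in>{1..N}. \<exists>n\<in>{1..N}. m \<noteq> n \<and> p m = i \<and> p n = i)"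
proof -
  \<comment> \<open>The second copies, tagged \<open>True\<close>, are provided only where \<open>P\<close> holds.\<close>
  define W where "W = {(i, b). i \<in> I \<and> (b \<longrightarrow> P i)}"
  have "W \<subseteq> I \<times> UNIV" by (auto simp: W_def)
  then have fin: "finite W"
    by (rule finite_subset) (simp add: assms(1))
  have ne: "W \<noteq> {}" using assms(2) by (auto simp: W_def)
  obtain h where h: "bij_betw h {1..card W} W"
    using ex_bij_betw_nat_finite_1[OF fin] by blast
  let ?V = "{1..card W}" and ?p = "fst \<circ> h"
  have hV: "h ` ?V = W" and inj: "inj_on h ?V" using h by (auto simp: bij_betw_def)
  have "?p ` ?V = fst ` W" using hV by (metis image_comp)
  also have "\<dots> = I" by (force simp: W_def)
  finally have img: "?p ` ?V = I" .
  have "P i \<longleftrightarrow> (\<exists>m\<in>?V. \<exists>n\<in>?V. m \<noteq> n \<and> ?p m = i \<and> ?p n = i)" if "i \<in> I" for i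
  proof
    assume "P i"
    then have "(i, True) \<in> h ` ?V" "(i, False) \<in> h ` ?V"
      using \<open>i \<in> I\<close> by (simp_all only: hV, simp_all add: W_def)
    then obtain m n where mn: "m \<in> ?V" "n \<in> ?V" "h m = (i, True)" "h n = (i, False)"
      by (metis imageE)
    then have "m \<noteq> n" by auto
    with mn show "\<exists>m\<in>?V. \<exists>n\<in>?V. m \<noteq> n \<and> ?p m = i \<and> ?p n = i"
      by (metis comp_apply fst_conv)
  next
    assume "\<exists>m\<in>?V. \<exists>n\<in>?V. m \<noteq> n \<and> ?p m = i \<and> ?p n = i"
    then obtain m n where mn: "m \<in> ?V" "n \<in> ?V" "m \<noteq> n" "fst (h m) = i" "fst (h n) = i"
      by auto
    have "h m \<noteq> h n" using inj mn by (auto dest: inj_onD)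
    moreover have "h m \<in> W" "h n \<in> W" using hV mn by blast+
    ultimately show "P i" using mn by (cases "h m"; cases "h n") (auto simp: W_def)
  qed
  then have "\<forall>i\<in>I. P i \<longleftrightarrow> (\<exists>m\<in>?V. \<exists>n\<in>?V. m \<noteq> n \<and> ?p m = i \<and> ?p n = i)"
    by (rule ballI)
  moreover have "card W \<ge> 1" using fin ne by (simp add: Suc_le_eq card_gt_0_iff)
  ultimately show thesis using img by (intro that[of "card W" ?p])
qed

theorem proposition6p5p1:
  fixes Q :: "'a bigraph"
  assumes "quasi_crystallograph Q"
    and "\<not> (\<exists>H\<in>components Q. \<exists>d1 d2. bipartite_type d1 d2 H)"
  shows "\<exists>N \<ge> (1::nat). \<exists>G G' :: nat bigraph.
           nodes G = {1..N} \<and> nodes G' = {1..N} \<and>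
           crystallograph G \<and> crystallograph G' \<and> subgraph G' G \<and>
           (\<exists>F. (\<forall>H\<in>F. classical_type H) \<and> disjoint_union F G) \<and>
           (\<exists>F'. (\<forall>H\<in>F'. classical_type H) \<and> disjoint_union F' G') \<and>
           equal_up_to_relabelling Q (quotient_graph G G')"
proof -
  have bi: "bichromatic_graph Q"
    using assms(1) by (simp add: quasi_crystallograph_def)
  then have fin: "finite (nodes Q)" and ne: "nodes Q \<noteq> {}"
    by (auto simp: bichromatic_graph_def)
  obtain N :: nat and p where N: "N \<ge> 1" and p: "p ` {1..N} = nodes Q"
    and green: "\<forall>i\<in>nodes Q. loop Q Green i \<longleftrightarrow>
      (\<exists>m\<in>{1..N}. \<exists>n\<in>{1..N}. m \<noteq> n \<and> p m = i \<and> p n = i)"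
    by (rule doubling[OF fin ne, of "loop Q Green"]) (rule that, assumption+)
  let ?V = "{1..N}"
  let ?G = "blow_up Q p ?V" and ?G' = "fibre_graph p ?V"
  have V: "finite ?V" "?V \<noteq> {}" using N by auto
  have G: "crystallograph ?G"
  proof (rule crystallograph_blow_up[OF assms(1) V])
    show "p ` ?V \<subseteq> nodes Q" using p by simp
    show "loop Q Green (p m)" if "m \<in> ?V" "n \<in> ?V" "m \<noteq> n" "p m = p n" for m n
      using bspec[OF green, of "p m"] p that by (metis imageI)
  qed
  have G': "crystallograph ?G'" by (rule crystallograph_fibre_graph[OF V])
  have "\<exists>F. (\<forall>H\<in>F. classical_type H) \<and> disjoint_union F ?G"
    by (rule classical_decomposition[OF G])
      (auto simp: straight_blow_up intro: green_imp_red[OF assms])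
  moreover have "\<exists>F'. (\<forall>H\<in>F'. classical_type H) \<and> disjoint_union F' ?G'"
    by (rule classical_decomposition[OF G']) (simp add: straight_fibre_graph)
  moreover have "equal_up_to_relabelling Q (quotient_graph ?G ?G')"
    by (rule quotient_blow_up[OF bi V(1) p]) (rule bspec[OF green])
  ultimately show ?thesis
    using N G G' subgraph_fibre_graph[of p ?V Q]
    by (intro exI[of _ N] exI[of _ ?G] exI[of _ ?G'] conjI) simp_all
qed

end
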